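(* For every integer $m>1$, the shift graph $H_m$ is isomorphic to the disjointness graph of a family of sets indexed by its vertices, where each vertex can be represented by (i) a line minus a point in $\mathbb{R}^2$; (ii) a two-dimensional plane in $\mathbb{R}^4$; (iii) the intersection of two half-spaces in general position in $\mathbb{R}^3$; (iv) the union of two segments in $\mathbb{R}^2$; (v) a triangle in $\mathbb{R}^4$; (vi) a simplex in $\mathbb{R}^3$; (vii) a polygonal curve in $\mathbb{R}^2$ consisting of four line segments. (Each item is a separate statement: for each type, there is such a representation with all sets of that type.)
   Context: The shift graph $H_m$ has vertex set all ordered pairs $(i,j)$ of integers with $1\le i<j\le m$, and $(i,j)$ and $(k,l)$ are adjacent if and only if $j=k$ or $l=i$. The disjointness graph of a family of sets is the graph whose vertices are the members, two adjacent iff the corresponding sets are disjoint. *)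

theory Defs
  imports "HOL-Analysis.Analysis"
begin

text \<open>Simple graphs, given by a vertex set and a (symmetric, irreflexive) adjacency relation.
  The relation is only relevant on the vertex set.\<close>

record 'v sgraph =
  verts :: "'v set"
  adj :: "'v \<Rightarrow> 'v \<Rightarrow> bool"

definition graph_isomorphism :: "('v \<Rightarrow> 'w) \<Rightarrow> 'v sgraph \<Rightarrow> 'w sgraph \<Rightarrow> bool" where
  "graph_isomorphism f G H \<longleftrightarrow>
     bij_betw f (verts G) (verts H) \<and>
     (\<forall>u\<in>verts G. \<forall>v\<in>verts G. adj G u v \<longleftrightarrow> adj H (f u) (f v))"

definition shift_graph :: "nat \<Rightarrow> (nat \<times> nat) sgraph" where
  "shift_graph m =
     \<lparr> verts = {(i, j). 1 \<le> i \<and> i < j \<and> j \<le> m},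
       adj = (\<lambda>(i, j) (k, l). j = k \<or> l = i) \<rparr>"

definition disjointness_graph :: "'a set set \<Rightarrow> 'a set sgraph" where
  "disjointness_graph F =
     \<lparr> verts = F, adj = (\<lambda>A B. A \<noteq> B \<and> A \<inter> B = {}) \<rparr>"

text \<open>The family is indexed by the vertices of \<open>G\<close>, and the indexing map itself is
  the isomorphism; in particular distinct vertices are represented by distinct sets.\<close>

definition disjointness_representable :: "'v sgraph \<Rightarrow> ('a set \<Rightarrow> bool) \<Rightarrow> bool" where
  "disjointness_representable G P \<longleftrightarrow>
     (\<exists>S. graph_isomorphism S G (disjointness_graph (S ` verts G)) \<and>
          (\<forall>v\<in>verts G. P (S v)))"

definition is_line :: "'a::euclidean_space set \<Rightarrow> bool" where
  "is_line L \<longleftrightarrow> affine L \<and> aff_dim L = 1"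

definition is_line_minus_point :: "'a::euclidean_space set \<Rightarrow> bool" where
  "is_line_minus_point A \<longleftrightarrow> (\<exists>L p. is_line L \<and> p \<in> L \<and> A = L - {p})"

definition is_plane :: "'a::euclidean_space set \<Rightarrow> bool" where
  "is_plane A \<longleftrightarrow> affine A \<and> aff_dim A = 2"

text \<open>Half-spaces are closed. Two half-spaces are in general position when their normal vectors
  are linearly independent, i.e. their bounding hyperplanes are not parallel. The condition
  \<open>a \<noteq> c\<close> is needed because \<open>{a, c}\<close> collapses to a singleton otherwise.\<close>

definition is_halfspace_intersection :: "'a::euclidean_space set \<Rightarrow> bool" where
  "is_halfspace_intersection A \<longleftrightarrow>
     (\<exists>a b c d. a \<noteq> c \<and> independent {a, c} \<and>
        A = {x. a \<bullet> x \<le> b} \<inter> {x. c \<bullet> x \<le> d})"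

definition is_union_of_two_segments :: "'a::euclidean_space set \<Rightarrow> bool" where
  "is_union_of_two_segments A \<longleftrightarrow>
     (\<exists>a b c d. a \<noteq> b \<and> c \<noteq> d \<and> A = closed_segment a b \<union> closed_segment c d)"

text \<open>The segments are nondegenerate; the curve may cross itself.\<close>

definition is_four_segment_curve :: "'a::euclidean_space set \<Rightarrow> bool" where
  "is_four_segment_curve A \<longleftrightarrow>
     (\<exists>p0 p1 p2 p3 p4. p0 \<noteq> p1 \<and> p1 \<noteq> p2 \<and> p2 \<noteq> p3 \<and> p3 \<noteq> p4 \<and>
        A = path_image (linepath p0 p1 +++ linepath p1 p2 +++ linepath p2 p3 +++ linepath p3 p4))"

end

theory Submission
  imports Defs
begin

text \<open>The plane and half-space representations attach to every index \<open>i\<close> two disjoint parallel sets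
  \<open>h\<^sub>i\<close> and \<open>h'\<^sub>i\<close> and represent \<open>(i, j)\<close> by \<open>h\<^sub>i \<inter> h'\<^sub>j\<close>: then \<open>(i, j)\<close> and \<open>(j, k)\<close> are separated by
  \<open>h'\<^sub>j\<close> and \<open>h\<^sub>j\<close>, and all other pairs meet by general position. Triangles and tetrahedra are cut out of
  these unbounded sets. The line representations use lines in general position, the \<open>i\<close>-th line being
  interrupted where it crosses the \<open>j\<close>-th.\<close>

subsection \<open>Representations of the shift graph\<close>

text \<open>Four half-spaces in R^3 need not have a common point, even in general position. Reading
  points as cubics with leading coefficient -1 turns membership into a sign pattern: since first
  indices precede second ones, two nonadjacent vertices ask, up to coincidences, for + + - - or + -
  + - in increasing order of the indices. Such a cubic with one or three real roots realizes these.
  In R^4 all cubics are available, and interpolation at four nodes replaces the signs.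

  For the polygonal curves the obstacle is connectedness. The vertical segment at \<open>i\<close>
  and the raised chord of \<open>(i, j)\<close> must be joined without touching any curve of
  \<open>(h, i)\<close>. Those curves pass through the slit between T_i and the raised chord, so the
  joint has to go around their left ends; the lines \<open>x + y = - i\<close>, moving down as
  \<open>i\<close> grows, leave room for this.\<close>

text \<open>Injectivity of the indexing map is automatic, because the shift graph has no twins: the
  neighbours of a vertex determine it.\<close>
lemma disjointness_representable_shiftI:
  fixes S :: "nat \<times> nat \<Rightarrow> 'a set"
  assumes disj: "\<And>u v. u \<in> verts (shift_graph m) \<Longrightarrow> v \<in> verts (shift_graph m) \<Longrightarrow>
      S u \<inter> S v = {} \<longleftrightarrow> adj (shift_graph m) u v"
    and P: "\<And>v. v \<in> verts (shift_graph m) \<Longrightarrow> P (S v)"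
  shows "disjointness_representable (shift_graph m) P"
proof -
  let ?G = "shift_graph m"
  have twins: "u = v"
    if uv: "u \<in> verts ?G" "v \<in> verts ?G"
      and same: "\<And>w. w \<in> verts ?G \<Longrightarrow> adj ?G u w = adj ?G v w" for u v
  proof -
    obtain i j k l where [simp]: "u = (i, j)" "v = (k, l)" by (metis surj_pair)
    have *: "1 \<le> i" "i < j" "j \<le> m" "1 \<le> k" "k < l" "l \<le> m"
      using uv by (auto simp: shift_graph_def)
    have s: "(j = a \<or> b = i) = (l = a \<or> b = k)" if "1 \<le> a" "a < b" "b \<le> m" for a b
      using same[of "(a, b)"] that by (simp add: shift_graph_def)
    \<comment> \<open>\<open>(a, m)\<close> is adjacent to exactly the vertices ending at
      \<open>a\<close>, since \<open>m\<close> is never a first index. It exists only for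
      \<open>a < m\<close>, but two second indices that both equal \<open>m\<close> agree anyway.
      Dually, \<open>(1, a)\<close> detects the first index.\<close>
    have "j = l"
      using s[of j m] s[of l m] * by (cases "j < m"; cases "l < m") auto
    moreover have "i = k"
      using s[of 1 i] s[of 1 k] * by (cases "1 < i"; cases "1 < k") auto
    ultimately show ?thesis by simp
  qed
  have irrefl: "\<not> adj ?G v v" if "v \<in> verts ?G" for v
    using that by (auto simp: shift_graph_def)
  have inj: "inj_on S (verts ?G)"
  proof (rule inj_onI)
    fix u v assume uv: "u \<in> verts ?G" "v \<in> verts ?G" "S u = S v"
    then have "adj ?G u w = adj ?G v w" if "w \<in> verts ?G" for w
      using disj[OF uv(1) that] disj[OF uv(2) that] by simp
    then show "u = v"
      by (rule twins[OF uv(1,2)])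
  qed
  have "adj ?G u v \<longleftrightarrow> S u \<noteq> S v \<and> S u \<inter> S v = {}"
    if uv: "u \<in> verts ?G" "v \<in> verts ?G" for u v
    using disj[OF uv] irrefl[OF uv(1)] inj_on_eq_iff[OF inj uv] by auto
  then have "graph_isomorphism S ?G (disjointness_graph (S ` verts ?G))"
    using inj by (simp add: graph_isomorphism_def disjointness_graph_def bij_betw_def)
  with P show ?thesis
    by (auto simp: disjointness_representable_def)
qed

text \<open>Both relations are symmetric, so the pairs may be ordered by \<open>i \<le> k\<close>;
  then \<open>l = i\<close> is impossible and only \<open>j = k\<close> gives adjacency. The case
  \<open>i = k\<close> of \<open>meet\<close> includes \<open>u = v\<close>, that is,
  nonemptiness.\<close>

lemma shift_disjoint_iff:
  fixes S :: "nat \<times> nat \<Rightarrow> 'a set"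
  assumes disjoint: "\<And>i j k. 1 \<le> i \<Longrightarrow> i < j \<Longrightarrow> j < k \<Longrightarrow> k \<le> m \<Longrightarrow> S (i, j) \<inter> S (j, k) = {}"
    and meet: "\<And>i j k l. 1 \<le> i \<Longrightarrow> i < j \<Longrightarrow> j \<le> m \<Longrightarrow> i \<le> k \<Longrightarrow> k < l \<Longrightarrow> l \<le> m \<Longrightarrow> j \<noteq> k \<Longrightarrow>
      S (i, j) \<inter> S (k, l) \<noteq> {}"
    and uv: "u \<in> verts (shift_graph m)" "v \<in> verts (shift_graph m)"
  shows "S u \<inter> S v = {} \<longleftrightarrow> adj (shift_graph m) u v"
proof -
  obtain i j k l where [simp]: "u = (i, j)" "v = (k, l)" by (metis surj_pair)
  have *: "1 \<le> i" "i < j" "j \<le> m" "1 \<le> k" "k < l" "l \<le> m"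
    using uv by (auto simp: shift_graph_def)
  consider "j = k" | "l = i" | "j \<noteq> k" "i \<le> k" "l \<noteq> i" | "l \<noteq> i" "k \<le> i" "j \<noteq> k" by linarith
  then show ?thesis
  proof cases
    case 1
    then show ?thesis using disjoint[of i j l] * by (simp add: shift_graph_def)
  next
    case 2
    then show ?thesis using disjoint[of k i j] * by (simp add: shift_graph_def Int_commute)
  next
    case 3
    then show ?thesis using meet[of i j k l] * by (simp add: shift_graph_def)
  next
    case 4
    then show ?thesis using meet[of k l i j] * by (simp add: shift_graph_def Int_commute)
  qed
qed

lemma finite_verts_shift_graph: "finite (verts (shift_graph m))"
  by (rule finite_subset[of _ "{..m} \<times> {..m}"]) (auto simp: shift_graph_def)

text \<open>Sets may be shrunk as long as they keep one point of each nonempty pairwise intersection.\<close>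
lemma disjointness_representable_shrink:
  fixes S :: "nat \<times> nat \<Rightarrow> 'a set"
  assumes disj: "\<And>u v. u \<in> verts (shift_graph m) \<Longrightarrow> v \<in> verts (shift_graph m) \<Longrightarrow>
      S u \<inter> S v = {} \<longleftrightarrow> adj (shift_graph m) u v"
    and shrink: "\<And>v K. v \<in> verts (shift_graph m) \<Longrightarrow> finite K \<Longrightarrow> K \<subseteq> S v \<Longrightarrow>
      \<exists>T. P T \<and> K \<subseteq> T \<and> T \<subseteq> S v"
  shows "disjointness_representable (shift_graph m) P"
proof -
  let ?V = "verts (shift_graph m)"
  \<comment> \<open>The choice depends only on the intersection, hence is symmetric: both shrunken
    sets keep the same witness.\<close>
  define w where "w u v = (SOME x. x \<in> S u \<inter> S v)" for u v
  have w_comm: "w u v = w v u" for u v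
    by (simp add: w_def Int_commute)
  have w: "w u v \<in> S u \<inter> S v" if "S u \<inter> S v \<noteq> {}" for u v
  proof -
    have "\<exists>x. x \<in> S u \<inter> S v" using that by blast
    then show ?thesis unfolding w_def by (rule someI_ex)
  qed
  define K where "K v = w v ` {u \<in> ?V. S v \<inter> S u \<noteq> {}}" for v
  have K: "finite (K v)" "K v \<subseteq> S v" for v
  proof -
    show "finite (K v)" by (simp add: K_def finite_verts_shift_graph)
    show "K v \<subseteq> S v" using w[of v] unfolding K_def by blast
  qed
  have "\<exists>T. P T \<and> K v \<subseteq> T \<and> T \<subseteq> S v" if "v \<in> ?V" for v
    using shrink[OF that K] .
  then have "\<exists>T. \<forall>v\<in>?V. P (T v) \<and> K v \<subseteq> T v \<and> T v \<subseteq> S v"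
    by (intro bchoice) simp
  then obtain T where T: "\<And>v. v \<in> ?V \<Longrightarrow> P (T v) \<and> K v \<subseteq> T v \<and> T v \<subseteq> S v"
    by blast
  show ?thesis
  proof (rule disjointness_representable_shiftI)
    fix u v assume uv: "u \<in> ?V" "v \<in> ?V"
    show "T u \<inter> T v = {} \<longleftrightarrow> adj (shift_graph m) u v"
    proof
      assume "T u \<inter> T v = {}"
      moreover have "w u v \<in> K u \<inter> K v" if "S u \<inter> S v \<noteq> {}"
      proof
      show "w u v \<in> K u"
        using that uv(2) by (auto simp: K_def)
      have "w v u \<in> K v"
        using that uv(1) by (auto simp: K_def Int_commute)
      then show "w u v \<in> K v" by (simp only: w_comm)
    qed
      ultimately have "S u \<inter> S v = {}"
        using T uv by blast
      then show "adj (shift_graph m) u v"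
        using disj uv by simp
    next
      assume "adj (shift_graph m) u v"
      then show "T u \<inter> T v = {}"
        using disj[OF uv] T uv by blast
    qed
  qed (use T in blast)
qed

subsection \<open>Simplices inside affine sets and intersections of half-spaces\<close>

text \<open>A finite subset of a simplicial cone lies in a large enough corner of it: once
  \<open>R\<close> exceeds all coordinate sums, the coordinates divided by \<open>R\<close>, with
  the remaining weight at the apex, are barycentric.\<close>

lemma corner_simplex:
  fixes D :: "'b \<Rightarrow> 'a::euclidean_space"
  assumes I: "finite I" "inj_on D I" "independent (D ` I)" and K: "finite K"
    and cone: "\<And>x. x \<in> K \<Longrightarrow> \<exists>u. (\<forall>i\<in>I. 0 \<le> u i) \<and> x = p + (\<Sum>i\<in>I. u i *\<^sub>R D i)"
  obtains R :: real where "0 < R"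
    "int (card I) simplex (convex hull (insert p ((\<lambda>i. p + R *\<^sub>R D i) ` I)))"
    "K \<subseteq> convex hull (insert p ((\<lambda>i. p + R *\<^sub>R D i) ` I))"
proof -
  have "\<exists>u. \<forall>x\<in>K. (\<forall>i\<in>I. 0 \<le> u x i) \<and> x = p + (\<Sum>i\<in>I. u x i *\<^sub>R D i)"
    using cone by (intro bchoice) blast
  then obtain u where u: "\<And>x i. x \<in> K \<Longrightarrow> i \<in> I \<Longrightarrow> 0 \<le> u x i"
    "\<And>x. x \<in> K \<Longrightarrow> x = p + (\<Sum>i\<in>I. u x i *\<^sub>R D i)"
    by metis
  \<comment> \<open>The summand 1 keeps \<open>R\<close> positive when \<open>K\<close> is empty or
    consists of the apex.\<close>
  define R where "R = 1 + (\<Sum>x\<in>K. \<Sum>i\<in>I. u x i)"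
  have R: "0 < R" "\<And>x. x \<in> K \<Longrightarrow> (\<Sum>i\<in>I. u x i) \<le> R"
  proof -
    have "0 \<le> (\<Sum>x\<in>K. \<Sum>i\<in>I. u x i)"
      by (intro sum_nonneg u)
    then show "0 < R" by (simp add: R_def)
    fix x assume "x \<in> K"
    then have "(\<Sum>i\<in>I. u x i) \<le> (\<Sum>x\<in>K. \<Sum>i\<in>I. u x i)"
      by (intro member_le_sum[where f="\<lambda>x. \<Sum>i\<in>I. u x i"] sum_nonneg u K) auto
    then show "(\<Sum>i\<in>I. u x i) \<le> R" by (simp add: R_def)
  qed
  let ?W = "(\<lambda>i. p + R *\<^sub>R D i) ` I"
  have nz: "D i \<noteq> 0" if "i \<in> I" for i
    using I(3) that dependent_zero[of "D ` I"] by (metis imageI)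
  have p: "p \<notin> ?W"
    using nz R by auto
  have "independent ((*\<^sub>R) R ` D ` I)"
    using R(1) by (intro linear_independent_injective_image[OF _ I(3)])
      (auto simp: inj_on_def intro: linearI simp: algebra_simps)
  moreover have "(\<lambda>x. -p + x) ` ?W = (*\<^sub>R) R ` D ` I"
    by (simp add: image_image)
  ultimately have indep: "\<not> affine_dependent (insert p ?W)"
    using affine_dependent_iff_dependent[OF p] by simp
  have "inj_on (\<lambda>i. p + R *\<^sub>R D i) I"
    using I(2) R(1) by (auto simp: inj_on_def)
  then have "int (card (insert p ?W)) = int (card I) + 1"
    using p I(1) by (simp add: card_image)
  with indep have 1: "int (card I) simplex (convex hull (insert p ?W))"
    by (rule simplex_convex_hull[OF conjI])
  have "x \<in> convex hull (insert p ?W)" if x: "x \<in> K" for x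
  proof -
    define y where "y = p + (\<Sum>i\<in>I. u x i *\<^sub>R D i)"
    \<comment> \<open>The index \<open>None\<close> stands for the apex, \<open>Some i\<close> for
      the vertex in direction \<open>D i\<close>.\<close>
    define v where "v = (\<lambda>i. case i of None \<Rightarrow> 1 - (\<Sum>i\<in>I. u x i) / R | Some i \<Rightarrow> u x i / R)"
    define q where "q = (\<lambda>i. case i of None \<Rightarrow> p | Some i \<Rightarrow> p + R *\<^sub>R D i)"
    let ?J = "insert None (Some ` I)"
    have "(\<Sum>i\<in>?J. v i *\<^sub>R q i) \<in> convex hull (insert p ?W)"
    proof (rule convex_sum)
      show "sum v ?J = 1"
        using I(1) by (simp add: v_def sum.reindex sum_divide_distrib)
      show "0 \<le> v i" if "i \<in> ?J" for i
        using that R x u(1) by (auto simp: v_def)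
      show "q i \<in> convex hull (insert p ?W)" if "i \<in> ?J" for i
        using that hull_subset[of "insert p ?W" convex] by (auto simp: q_def split: option.splits)
    qed (use I in auto)
    also have "(\<Sum>i\<in>?J. v i *\<^sub>R q i) = y"
      using I(1) R(1)
      by (simp add: v_def q_def sum.reindex y_def algebra_simps sum.distrib
          flip: scaleR_sum_left sum_divide_distrib)
    finally show ?thesis
      using u(2)[OF x] by (simp add: y_def)
  qed
  then show ?thesis
    using that[OF R(1) 1] by blast
qed

text \<open>Coordinates of \<open>K\<close> relative to a point of \<open>L\<close> may be negative.
  Moving the apex back by a bound \<open>M b\<close> along each basis vector makes them nonnegative,
  so that \<open>corner_simplex\<close> applies.\<close>

lemma affine_contains_simplex:
  fixes L :: "'a::euclidean_space set"
  assumes L: "affine L" "aff_dim L = int n" and K: "finite K" "K \<subseteq> L"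
  shows "\<exists>T. int n simplex T \<and> K \<subseteq> T \<and> T \<subseteq> L"
proof -
  have "L \<noteq> {}"
    using L(2) aff_dim_empty[of L] by linarith
  then obtain p where p: "p \<in> L" by blast
  define V where "V = (+) (-p) ` L"
  have V: "subspace V"
    unfolding V_def using affine_diffs_subspace[OF L(1) p] by simp
  have dimV: "dim V = n"
    using aff_dim_eq_dim[of p L] p L(2) by (simp add: V_def hull_inc)
  obtain B where B: "B \<subseteq> V" "independent B" "V \<subseteq> span B" "card B = n"
    using basis_exists[of V] unfolding dimV .
  have finB: "finite B" by (rule independent_imp_finite[OF B(2)])
  have coord: "\<exists>c. x - p = (\<Sum>b\<in>B. c b *\<^sub>R b)" if "x \<in> K" for x
  proof -
    have "- p + x \<in> V"
      using that K(2) unfolding V_def by blast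
    then have "x - p \<in> span B"
      using B(3) by (simp add: subset_iff)
    then show ?thesis
      unfolding span_finite[OF finB] by (simp add: image_iff)
  qed
  have "\<exists>c. \<forall>x\<in>K. x - p = (\<Sum>b\<in>B. c x b *\<^sub>R b)"
    using coord by (intro bchoice) simp
  then obtain c where c: "\<And>x. x \<in> K \<Longrightarrow> x - p = (\<Sum>b\<in>B. c x b *\<^sub>R b)"
    by auto
  define M where "M b = (\<Sum>x\<in>K. \<bar>c x b\<bar>)" for b
  have M: "0 \<le> M b + c x b" if "x \<in> K" for x b
    using member_le_sum[of x K "\<lambda>x. \<bar>c x b\<bar>"] K(1) that by (auto simp: M_def)
  define q where "q = p - (\<Sum>b\<in>B. M b *\<^sub>R b)"
  have mem: "p + y \<in> L" if "y \<in> span B" for y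
  proof -
    have "y \<in> V" using span_minimal[OF B(1) V] that ..
    then obtain z where "z \<in> L" "y = - p + z" unfolding V_def by blast
    then show ?thesis by simp
  qed
  have sumB: "(\<Sum>b\<in>B. M b *\<^sub>R b) \<in> span B"
    by (intro span_sum span_scale span_base)
  obtain R :: real where R:
    "int (card B) simplex (convex hull (insert q ((\<lambda>b. q + R *\<^sub>R b) ` B)))"
    "K \<subseteq> convex hull (insert q ((\<lambda>b. q + R *\<^sub>R b) ` B))"
  proof (rule corner_simplex[of B "\<lambda>b. b" K q])
    fix x assume x: "x \<in> K"
    have "q + (\<Sum>b\<in>B. (M b + c x b) *\<^sub>R b) = p + (\<Sum>b\<in>B. c x b *\<^sub>R b)"
      by (simp add: q_def algebra_simps sum.distrib)
    then have "x = q + (\<Sum>b\<in>B. (M b + c x b) *\<^sub>R b)"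
      by (simp flip: c[OF x])
    then show "\<exists>u. (\<forall>b\<in>B. 0 \<le> u b) \<and> x = q + (\<Sum>b\<in>B. u b *\<^sub>R b)"
      using M[OF x] by (intro exI[of _ "\<lambda>b. M b + c x b"]) simp
  qed (use finB B K in auto)
  have "q \<in> L"
    using mem[of "- (\<Sum>b\<in>B. M b *\<^sub>R b)"] sumB by (simp add: q_def span_neg)
  moreover have "q + R *\<^sub>R b \<in> L" if "b \<in> B" for b
    using mem[of "R *\<^sub>R b - (\<Sum>b\<in>B. M b *\<^sub>R b)"] sumB that
    by (simp add: q_def span_diff span_scale span_base algebra_simps)
  ultimately have "convex hull (insert q ((\<lambda>b. q + R *\<^sub>R b) ` B)) \<subseteq> L"
    using L(1) by (intro hull_minimal) (auto simp: affine_imp_convex)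
  with R B(4) show ?thesis by auto
qed

text \<open>The component \<open>z\<close> of \<open>a\<close> orthogonal to the span of the other
  vectors is nonzero by independence and satisfies \<open>a \<bullet> z = z \<bullet> z\<close>; it
  only has to be rescaled.\<close>

lemma independent_dual_vector:
  fixes A :: "'a::euclidean_space set"
  assumes "independent A" "a \<in> A"
  shows "\<exists>d. a \<bullet> d = 1 \<and> (\<forall>b\<in>A - {a}. b \<bullet> d = 0)"
proof -
  obtain y z where yz: "y \<in> span (A - {a})" "\<And>w. w \<in> span (A - {a}) \<Longrightarrow> orthogonal z w" "a = y + z"
    using orthogonal_subspace_decomp_exists[of "A - {a}" a] by metis
  have "z \<noteq> 0"
    using assms yz by (auto simp: dependent_def)
  moreover have "y \<bullet> z = 0"
    using yz by (simp add: orthogonal_def inner_commute)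
  ultimately have "a \<bullet> (z /\<^sub>R (z \<bullet> z)) = 1"
    by (simp add: yz(3) inner_add_left)
  moreover have "b \<bullet> (z /\<^sub>R (z \<bullet> z)) = 0" if "b \<in> A - {a}" for b
    using yz(2)[OF span_base[OF that]] by (simp add: orthogonal_def inner_commute)
  ultimately show ?thesis by blast
qed

text \<open>With the normals extended to a basis \<open>B\<close> and \<open>D\<close> its dual
  basis, the cone at \<open>p\<close> in the directions \<open>- D b\<close> consists of the points
  with \<open>b \<bullet> x \<le> b \<bullet> p\<close> for all \<open>b \<in> B\<close>. A corner
  of it stays inside the given half-spaces.\<close>

lemma halfspaces_contain_simplex:
  fixes A :: "'a::euclidean_space set"
  assumes A: "independent A" and K: "finite K" "\<And>x a. x \<in> K \<Longrightarrow> a \<in> A \<Longrightarrow> a \<bullet> x \<le> f a"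
  shows "\<exists>T. int DIM('a) simplex T \<and> K \<subseteq> T \<and> T \<subseteq> {x. \<forall>a\<in>A. a \<bullet> x \<le> f a}"
proof -
  obtain B where B: "A \<subseteq> B" "independent B" "UNIV \<subseteq> span B"
    using maximal_independent_subset_extend[OF subset_UNIV A] by metis
  have finB: "finite B" by (rule independent_imp_finite[OF B(2)])
  have cardB: "card B = DIM('a)"
    using B by (metis dim_UNIV dim_eq_card span_UNIV top.extremum_uniqueI)
  obtain D where D: "\<And>a. a \<in> B \<Longrightarrow> a \<bullet> D a = 1" "\<And>a b. a \<in> B \<Longrightarrow> b \<in> B - {a} \<Longrightarrow> b \<bullet> D a = 0"
    using independent_dual_vector[OF B(2)] by metis
  have inner_sum_D: "a \<bullet> (\<Sum>b\<in>B. c b *\<^sub>R D b) = c a" if "a \<in> B" for a and c :: "'a \<Rightarrow> real"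
  proof -
    have "a \<bullet> (\<Sum>b\<in>B. c b *\<^sub>R D b) = (\<Sum>b\<in>B. if b = a then c b else 0)"
      unfolding inner_sum_right using D that by (intro sum.cong) auto
    then show ?thesis using finB that by simp
  qed
  \<comment> \<open>The difference of the two sides is orthogonal to a spanning set, hence to
    itself.\<close>
  have expand: "x = (\<Sum>b\<in>B. (b \<bullet> x) *\<^sub>R D b)" for x
  proof -
    let ?y = "x - (\<Sum>b\<in>B. (b \<bullet> x) *\<^sub>R D b)"
    have "b \<bullet> ?y = 0" if "b \<in> B" for b
      using inner_sum_D[OF that, of "\<lambda>b. b \<bullet> x"] by (simp add: inner_diff_right)
    then have "orthogonal ?y ?y"
      using orthogonal_to_span[of ?y B ?y] B(3) by (auto simp: orthogonal_def inner_commute)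
    then show ?thesis by (simp add: orthogonal_self)
  qed
  have injD: "inj_on (\<lambda>b. - D b) B"
    by (rule inj_onI) (metis D Diff_iff empty_iff insert_iff neg_equal_iff_equal zero_neq_one)
  have "span ((\<lambda>b. - D b) ` B) = UNIV"
  proof -
    have "(\<Sum>b\<in>B. (- (b \<bullet> x)) *\<^sub>R (- D b)) \<in> span ((\<lambda>b. - D b) ` B)" for x
      by (intro span_sum span_scale span_base) auto
    then show ?thesis using expand by auto
  qed
  then have indep: "independent ((\<lambda>b. - D b) ` B)"
    using injD finB cardB by (intro card_le_dim_spanning[of _ UNIV]) (auto simp: card_image)
  \<comment> \<open>For the auxiliary normals any upper bound on \<open>K\<close> will do.\<close>
  define g where "g b = (if b \<in> A then f b else (\<Sum>x\<in>K. \<bar>b \<bullet> x\<bar>))" for b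
  have g: "b \<bullet> x \<le> g b" if "x \<in> K" for x b
    using K that member_le_sum[of x K "\<lambda>x. \<bar>b \<bullet> x\<bar>"] by (auto simp: g_def)
  define p where "p = (\<Sum>b\<in>B. g b *\<^sub>R D b)"
  obtain R :: real where R: "0 < R"
    "int (card B) simplex (convex hull (insert p ((\<lambda>b. p + R *\<^sub>R - D b) ` B)))"
    "K \<subseteq> convex hull (insert p ((\<lambda>b. p + R *\<^sub>R - D b) ` B))"
  proof (rule corner_simplex[of B "\<lambda>b. - D b" K p])
    fix x assume x: "x \<in> K"
    have "p + (\<Sum>b\<in>B. (g b - b \<bullet> x) *\<^sub>R - D b) = (\<Sum>b\<in>B. (b \<bullet> x) *\<^sub>R D b)"
      by (simp add: p_def algebra_simps sum_subtractf sum_negf)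
    then have "x = p + (\<Sum>b\<in>B. (g b - b \<bullet> x) *\<^sub>R - D b)"
      using expand[of x] by simp
    then show "\<exists>u. (\<forall>b\<in>B. 0 \<le> u b) \<and> x = p + (\<Sum>b\<in>B. u b *\<^sub>R - D b)"
      using g[OF x] by (intro exI[of _ "\<lambda>b. g b - b \<bullet> x"]) auto
  qed (use finB injD indep K in auto)
  have p: "a \<bullet> p = f a" if "a \<in> A" for a
    using inner_sum_D[of a g] that B(1) by (auto simp: p_def g_def)
  have "a \<bullet> (p + R *\<^sub>R - D b) \<le> f a" if "a \<in> A" "b \<in> B" for a b
  proof -
    have "a \<bullet> D b \<ge> 0"
      using D that B(1) by (cases "a = b") auto
    then show ?thesis
      using p[OF that(1)] R(1) by (simp add: inner_diff_right)
  qed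
  moreover have "{x. \<forall>a\<in>A. a \<bullet> x \<le> f a} = (\<Inter>a\<in>A. {x. a \<bullet> x \<le> f a})" by auto
  then have "convex {x. \<forall>a\<in>A. a \<bullet> x \<le> f a}"
    by (simp add: convex_INT convex_halfspace_le)
  ultimately have "convex hull (insert p ((\<lambda>b. p + R *\<^sub>R - D b) ` B)) \<subseteq> {x. \<forall>a\<in>A. a \<bullet> x \<le> f a}"
    using p by (intro hull_minimal) auto
  with R cardB show ?thesis by auto
qed

subsection \<open>Planes, half-spaces and simplices\<close>

definition moment3 :: "real \<Rightarrow> real^3" where
  "moment3 t = vector [1, t, t\<^sup>2]"

definition moment4 :: "real \<Rightarrow> real^4" where
  "moment4 t = vector [1, t, t\<^sup>2, t ^ 3]"

lemma vector_4:
  "(vector [x, y, z, w] :: 'a::zero^4) $ 1 = x"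
  "(vector [x, y, z, w] :: 'a::zero^4) $ 2 = y"
  "(vector [x, y, z, w] :: 'a::zero^4) $ 3 = z"
  "(vector [x, y, z, w] :: 'a::zero^4) $ 4 = w"
  unfolding vector_def by simp_all

lemma inner_moment3: "moment3 t \<bullet> x = x $ 1 + t * x $ 2 + t\<^sup>2 * x $ 3"
  by (simp add: moment3_def inner_vec_def sum_3)

lemma inner_moment4: "moment4 t \<bullet> x = x $ 1 + t * x $ 2 + t\<^sup>2 * x $ 3 + t ^ 3 * x $ 4"
  by (simp add: moment4_def inner_vec_def sum_4 vector_4)

text \<open>The functions \<open>moment4 t \<bullet> x\<close> of \<open>t\<close> are exactly the
  polynomials of degree at most 3. Coincidences \<open>i = k\<close> and \<open>j = l\<close> are
  allowed, as two vertices may share an index.\<close>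

lemma moment4_interpolation:
  fixes i j k l :: real
  assumes "i \<noteq> j" "i \<noteq> l" "k \<noteq> j" "k \<noteq> l"
  shows "\<exists>x. moment4 i \<bullet> x = 0 \<and> moment4 k \<bullet> x = 0 \<and> moment4 j \<bullet> x = 1 \<and> moment4 l \<bullet> x = 1"
proof -
  \<comment> \<open>The cubic is \<open>(t - i) * (t - k)\<close> times the linear function that
    agrees with \<open>u\<close> at \<open>j\<close> and \<open>l\<close>. If \<open>j = l\<close>,
    division by zero gives \<open>\<beta> = 0\<close>, and the constant \<open>u j\<close>
    serves.\<close>
  define u where "u t = 1 / ((t - i) * (t - k))" for t
  define \<beta> where "\<beta> = (u j - u l) / (j - l)"
  define \<alpha> where "\<alpha> = u j - \<beta> * j"
  define x :: "real^4" where
    "x = vector [i * k * \<alpha>, i * k * \<beta> - (i + k) * \<alpha>, \<alpha> - (i + k) * \<beta>, \<beta>]"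
  have x: "moment4 t \<bullet> x = (t - i) * (t - k) * (\<alpha> + \<beta> * t)" for t
    by (simp add: inner_moment4 x_def vector_4 algebra_simps power2_eq_square power3_eq_cube)
  have "\<alpha> + \<beta> * j = u j"
    by (simp add: \<alpha>_def)
  moreover have "\<alpha> + \<beta> * l = u l"
  proof (cases "j = l")
    case False
    then have "\<beta> * (j - l) = u j - u l" by (simp add: \<beta>_def)
    then show ?thesis by (simp add: \<alpha>_def algebra_simps)
  qed (simp add: \<alpha>_def)
  moreover have "(t - i) * (t - k) * u t = 1" if "i \<noteq> t" "k \<noteq> t" for t
    using that by (simp add: u_def)
  ultimately have "moment4 j \<bullet> x = 1" "moment4 l \<bullet> x = 1"
    using assms by (simp_all only: x)
  moreover have "moment4 i \<bullet> x = 0" "moment4 k \<bullet> x = 0"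
    by (simp_all add: x)
  ultimately show ?thesis by blast
qed

text \<open>The hyperplanes \<open>moment4 j \<bullet> x = 0\<close> and \<open>moment4 j \<bullet> x = 1\<close> are parallel, while any
  hyperplanes with at most four distinct normals on the moment curve meet.\<close>

definition moment_plane :: "nat \<times> nat \<Rightarrow> (real^4) set" where
  "moment_plane = (\<lambda>(i, j). {x. moment4 (real i) \<bullet> x = 0} \<inter> {x. moment4 (real j) \<bullet> x = 1})"

lemma moment_plane_disjoint_iff:
  assumes "u \<in> verts (shift_graph m)" "v \<in> verts (shift_graph m)"
  shows "moment_plane u \<inter> moment_plane v = {} \<longleftrightarrow> adj (shift_graph m) u v"
proof (rule shift_disjoint_iff[OF _ _ assms])
  show "moment_plane (i, j) \<inter> moment_plane (j, k) = {}" for i j k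
    by (auto simp: moment_plane_def)
  fix i j k l :: nat
  assume "i < j" "i \<le> k" "k < l" "j \<noteq> k"
  then show "moment_plane (i, j) \<inter> moment_plane (k, l) \<noteq> {}"
    using moment4_interpolation[of i j l k] by (auto simp: moment_plane_def)
qed

lemma is_plane_moment_plane:
  assumes "i < j"
  shows "is_plane (moment_plane (i, j))"
proof -
  let ?H = "{x. moment4 (real i) \<bullet> x = 0}" and ?K = "{x. moment4 (real j) \<bullet> x = 1}"
  have "moment4 (real i) \<noteq> 0"
    by (metis moment4_def vector_4(1) zero_index zero_neq_one)
  then have H: "affine ?H" "aff_dim ?H = 3"
    by (simp_all add: affine_hyperplane aff_dim_hyperplane)
  have "?H \<inter> ?K \<noteq> {}"
    using moment4_interpolation[of i j j i] assms by auto
  \<comment> \<open>The origin rules out containment, so the section by \<open>?K\<close> loses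
    exactly one dimension.\<close>
  moreover have "0 \<in> ?H" "0 \<notin> ?K" by simp_all
  then have "\<not> ?H \<subseteq> ?K" by blast
  ultimately have "aff_dim (?H \<inter> ?K) = 2"
    using aff_dim_affine_Int_hyperplane[OF H(1), of "moment4 (real j)" 1] H(2) by simp
  then show ?thesis
    unfolding is_plane_def moment_plane_def using affine_hyperplane by (auto intro: affine_Int)
qed

lemma plane_representation:
  "disjointness_representable (shift_graph m) (is_plane :: (real^4) set \<Rightarrow> bool)"
  by (rule disjointness_representable_shiftI[OF moment_plane_disjoint_iff])
    (auto simp: shift_graph_def is_plane_moment_plane)

lemma triangle_representation:
  "disjointness_representable (shift_graph m) (\<lambda>T :: (real^4) set. 2 simplex T)"
proof (rule disjointness_representable_shrink[OF moment_plane_disjoint_iff])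
  fix v K assume v: "v \<in> verts (shift_graph m)" and K: "finite K" "K \<subseteq> moment_plane v"
  have "is_plane (moment_plane v)"
    using is_plane_moment_plane v by (auto simp: shift_graph_def)
  then show "\<exists>T. 2 simplex T \<and> K \<subseteq> T \<and> T \<subseteq> moment_plane v"
    using affine_contains_simplex[of "moment_plane v" 2 K] K by (simp add: is_plane_def)
qed

text \<open>A point \<open>x\<close> stands for the cubic \<open>moment3 t \<bullet> x - t ^ 3\<close>; the wedge of \<open>(i, j)\<close> asks it to be
  positive at \<open>i\<close> and negative at \<open>j\<close>, with margin \<open>1 / 8\<close>.\<close>

definition wedge :: "nat \<times> nat \<Rightarrow> (real^3) set" where
  "wedge = (\<lambda>(i, j). {x. - moment3 (real i) \<bullet> x \<le> - (real i ^ 3 + 1/8)} \<inter>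
     {x. moment3 (real j) \<bullet> x \<le> real j ^ 3 - 1/8})"

lemma wedge_disjoint_iff:
  assumes "u \<in> verts (shift_graph m)" "v \<in> verts (shift_graph m)"
  shows "wedge u \<inter> wedge v = {} \<longleftrightarrow> adj (shift_graph m) u v"
proof (rule shift_disjoint_iff[OF _ _ assms])
  show "wedge (i, j) \<inter> wedge (j, k) = {}" for i j k
    by (auto simp: wedge_def)
  fix i j k l :: nat
  assume ijkl: "i < j" "i \<le> k" "k < l" "j \<noteq> k"
  show "wedge (i, j) \<inter> wedge (k, l) \<noteq> {}"
  proof (cases "k < j")
    case True
    \<comment> \<open>Pattern + + - -: the factor \<open>t\<^sup>2 + 1\<close> has no real root, so
      the sign changes only at \<open>r\<close>, between \<open>k\<close> and the two second
      indices.\<close>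
    define r where "r = real k + 1/2"
    define x :: "real^3" where "x = vector [r, - 1, r]"
    have x: "moment3 t \<bullet> x = t ^ 3 + (r - t) * (t\<^sup>2 + 1)" for t
      by (simp add: inner_moment3 x_def algebra_simps power2_eq_square power3_eq_cube)
    have pos: "1/8 \<le> (r - t) * (t\<^sup>2 + 1)" if "t + 1/2 \<le> r" for t
      using mult_mono[of "1/8" "r - t" 1 "t\<^sup>2 + 1"] that by simp
    have neg: "(r - t) * (t\<^sup>2 + 1) \<le> - 1/8" if "r + 1/2 \<le> t" for t
      using mult_mono[of "1/8" "t - r" 1 "t\<^sup>2 + 1"] that by (simp add: algebra_simps)
    have "real i + 1/2 \<le> r" "real k + 1/2 \<le> r" "r + 1/2 \<le> real j" "r + 1/2 \<le> real l"
      using True ijkl by (simp_all add: r_def)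
    then have "x \<in> wedge (i, j) \<inter> wedge (k, l)"
      using pos[of i] pos[of k] neg[of j] neg[of l] by (simp add: wedge_def x)
    then show ?thesis by blast
  next
    case False
    \<comment> \<open>Pattern + - + -: one root half a unit below each of \<open>j\<close>,
      \<open>k\<close>, \<open>l\<close>. At an index every factor has absolute value at least 1/2,
      which is where the margin 1/8 comes from; the coordinates of \<open>x\<close> are given by
      Vieta's formulas.\<close>
    define a b c where "a = real j - 1/2" and "b = real k - 1/2" and "c = real l - 1/2"
    define x :: "real^3" where "x = vector [a * b * c, - (a * b + a * c + b * c), a + b + c]"
    have x: "moment3 t \<bullet> x = t ^ 3 + (a - t) * (b - t) * (c - t)" for t
      by (simp add: inner_moment3 x_def algebra_simps power2_eq_square power3_eq_cube)
    have prod: "1/8 \<le> p * q * r" if "1/2 \<le> p" "1/2 \<le> q" "1/2 \<le> r" for p q r :: real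
      using mult_mono[of "1/4" "p * q" "1/2" r] mult_mono[of "1/2" p "1/2" q] that by simp
    have o: "real i + 1 \<le> real j" "real j + 1 \<le> real k" "real k + 1 \<le> real l"
      using False ijkl by simp_all
    have "1/8 \<le> (a - real i) * (b - real i) * (c - real i)"
      using o by (intro prod) (simp_all add: a_def b_def c_def)
    moreover have "1/8 \<le> (real k - a) * (real k - b) * (c - real k)"
      using o by (intro prod) (simp_all add: a_def b_def c_def)
    moreover have "1/8 \<le> (real j - a) * (b - real j) * (c - real j)"
      using o by (intro prod) (simp_all add: a_def b_def c_def)
    moreover have "1/8 \<le> (real l - a) * (real l - b) * (real l - c)"
      using o by (intro prod) (simp_all add: a_def b_def c_def)
    ultimately have "x \<in> wedge (i, j) \<inter> wedge (k, l)"
      unfolding wedge_def by (simp add: x) (simp add: algebra_simps)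
    then show ?thesis by blast
  qed
qed

lemma independent_moment3:
  assumes "i \<noteq> j"
  shows "- moment3 i \<noteq> moment3 j" "independent {- moment3 i, moment3 j}"
proof -
  have not_scaled: "- moment3 i \<noteq> c *\<^sub>R moment3 j" for c
  proof
    assume "- moment3 i = c *\<^sub>R moment3 j"
    then have "(- moment3 i) $ n = (c *\<^sub>R moment3 j) $ n" for n by simp
    from this[of 1] this[of 2] show False
      using assms by (auto simp: moment3_def)
  qed
  from not_scaled[of 1] show "- moment3 i \<noteq> moment3 j" by simp
  have "moment3 j \<noteq> 0"
    by (metis moment3_def vector_3(1) zero_index zero_neq_one)
  then show "independent {- moment3 i, moment3 j}"
    using not_scaled by (auto simp: independent_insert span_singleton)
qed

lemma halfspace_representation:
  "disjointness_representable (shift_graph m) (is_halfspace_intersection :: (real^3) set \<Rightarrow> bool)"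
  using wedge_disjoint_iff
proof (rule disjointness_representable_shiftI)
  fix v assume "v \<in> verts (shift_graph m)"
  then obtain i j where "v = (i, j)" "real i \<noteq> real j"
    by (auto simp: shift_graph_def)
  then show "is_halfspace_intersection (wedge v)"
    unfolding is_halfspace_intersection_def wedge_def using independent_moment3[of i j] by blast
qed

lemma tetrahedron_representation:
  "disjointness_representable (shift_graph m) (\<lambda>T :: (real^3) set. 3 simplex T)"
proof (rule disjointness_representable_shrink[OF wedge_disjoint_iff])
  fix v K assume v: "v \<in> verts (shift_graph m)" and K: "finite K" "K \<subseteq> wedge v"
  obtain i j where ij: "v = (i, j)" "real i \<noteq> real j"
    using v by (auto simp: shift_graph_def)
  let ?A = "{- moment3 (real i), moment3 (real j)}"
  \<comment> \<open>Bounds are attached to normals; this is unambiguous because the two normals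
    differ.\<close>
  define f where "f a = (if a = moment3 (real j) then real j ^ 3 - 1/8 else - (real i ^ 3 + 1/8))" for a
  have wedge: "wedge v = {x. \<forall>a\<in>?A. a \<bullet> x \<le> f a}"
    using independent_moment3(1)[OF ij(2)] by (auto simp: wedge_def ij(1) f_def)
  have "\<exists>T. int DIM(real^3) simplex T \<and> K \<subseteq> T \<and> T \<subseteq> {x. \<forall>a\<in>?A. a \<bullet> x \<le> f a}"
    using K unfolding wedge
    by (intro halfspaces_contain_simplex independent_moment3(2) ij(2)) blast+
  then show "\<exists>T. 3 simplex T \<and> K \<subseteq> T \<and> T \<subseteq> wedge v"
    by (simp add: wedge)
qed

subsection \<open>Lines minus a point and pairs of segments\<close>

lemma vec2_eq_iff: "v = w \<longleftrightarrow> v $ 1 = w $ 1 \<and> v $ 2 = w $ 2" for v w :: "real^2"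
  by (simp add: vec_eq_iff forall_2)

lemma closed_segment_graph:
  fixes s b :: real
  assumes "x1 \<le> x2"
  shows "closed_segment (vector [x1, s * x1 + b]) (vector [x2, s * x2 + b]) =
    {v :: real^2. v $ 2 = s * v $ 1 + b \<and> x1 \<le> v $ 1 \<and> v $ 1 \<le> x2}"
    (is "closed_segment ?p ?q = ?G")
proof
  have "v \<in> ?G" if "v \<in> closed_segment ?p ?q" for v
  proof -
    obtain u where u: "0 \<le> u" "u \<le> 1" "v = (1 - u) *\<^sub>R ?p + u *\<^sub>R ?q"
      using \<open>v \<in> _\<close> unfolding in_segment by blast
    have "v $ 1 = x1 + u * (x2 - x1)" "v $ 2 = s * (x1 + u * (x2 - x1)) + b"
      by (simp_all add: u(3) algebra_simps)
    moreover have "0 \<le> u * (x2 - x1)" "u * (x2 - x1) \<le> x2 - x1"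
      using assms u by (simp_all add: mult_left_le_one_le)
    ultimately show ?thesis by simp
  qed
  then show "closed_segment ?p ?q \<subseteq> ?G" by blast
  show "?G \<subseteq> closed_segment ?p ?q"
  proof
    fix v assume v: "v \<in> ?G"
    then have "v $ 1 \<in> closed_segment x1 x2"
      using assms by (simp add: closed_segment_eq_real_ivl)
    then obtain u where u: "0 \<le> u" "u \<le> 1" "v $ 1 = (1 - u) * x1 + u * x2"
      by (auto simp: in_segment)
    have "v $ 2 = (1 - u) * (s * x1 + b) + u * (s * x2 + b)"
      using v u(3) by (simp add: algebra_simps)
    with u show "v \<in> closed_segment ?p ?q"
      unfolding in_segment by (intro exI[of _ u]) (simp add: vec2_eq_iff)
  qed
qed

lemma closed_segment_vertical:
  fixes a :: real
  assumes "y1 \<le> y2"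
  shows "closed_segment (vector [a, y2]) (vector [a, y1]) =
    {v :: real^2. v $ 1 = a \<and> y1 \<le> v $ 2 \<and> v $ 2 \<le> y2}"
    (is "closed_segment ?p ?q = ?G")
proof
  have "v \<in> ?G" if "v \<in> closed_segment ?p ?q" for v
  proof -
    obtain u where u: "0 \<le> u" "u \<le> 1" "v = (1 - u) *\<^sub>R ?p + u *\<^sub>R ?q"
      using \<open>v \<in> _\<close> unfolding in_segment by blast
    have "v $ 1 = a" "v $ 2 = y2 - u * (y2 - y1)"
      by (simp_all add: u(3) algebra_simps)
    moreover have "0 \<le> u * (y2 - y1)" "u * (y2 - y1) \<le> y2 - y1"
      using assms u by (simp_all add: mult_left_le_one_le)
    ultimately show ?thesis by simp
  qed
  then show "closed_segment ?p ?q \<subseteq> ?G" by blast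
  show "?G \<subseteq> closed_segment ?p ?q"
  proof
    fix v assume v: "v \<in> ?G"
    then have "v $ 2 \<in> closed_segment y2 y1"
      using assms by (simp add: closed_segment_eq_real_ivl)
    then obtain u where u: "0 \<le> u" "u \<le> 1" "v $ 2 = (1 - u) * y2 + u * y1"
      by (auto simp: in_segment)
    have "v $ 1 = (1 - u) * a + u * a"
      using v by (simp add: algebra_simps)
    with u show "v \<in> closed_segment ?p ?q"
      unfolding in_segment by (intro exI[of _ u]) (simp add: vec2_eq_iff)
  qed
qed

lemma is_line_graph: "is_line {v :: real^2. v $ 2 = s * v $ 1 + b}"
proof -
  let ?a = "vector [- s, 1] :: real^2"
  have "{v :: real^2. v $ 2 = s * v $ 1 + b} = {v. ?a \<bullet> v = b}"
    by (auto simp: inner_vec_def sum_2)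
  moreover have "?a \<noteq> 0"
    by (simp add: vec2_eq_iff)
  ultimately show ?thesis
    by (simp add: is_line_def affine_hyperplane aff_dim_hyperplane)
qed

text \<open>The lines are the tangents of the parabola \<open>y = x\<^sup>2\<close> at the points with abscissa \<open>i\<close>; the
  tangents at \<open>i\<close> and \<open>k\<close> cross at abscissa \<open>(i + k) / 2\<close>.\<close>

lemma tangents_cross:
  fixes i j x :: real
  assumes "2 * i * x - i\<^sup>2 = 2 * j * x - j\<^sup>2" "i \<noteq> j"
  shows "x = (i + j) / 2"
proof -
  have "(i - j) * (2 * x - (i + j)) = 0"
    using assms(1) by (simp add: algebra_simps power2_eq_square)
  with assms(2) show ?thesis by simp
qed

text \<open>Common frame for both line representations: \<open>X i j\<close> is the set of abscissae
  kept on the \<open>i\<close>-th tangent. The abscissa 0 is a common point for vertices with equal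
  first index, which lie on the same tangent; it is never a crossing, as indices are
  positive.\<close>

lemma tangents_representation:
  fixes X :: "nat \<Rightarrow> nat \<Rightarrow> real set"
  defines "S \<equiv> \<lambda>(i, j). {v :: real^2. v $ 2 = 2 * real i * v $ 1 - (real i)\<^sup>2 \<and> v $ 1 \<in> X i j}"
  assumes gap: "\<And>i j. 1 \<le> i \<Longrightarrow> i < j \<Longrightarrow> j \<le> m \<Longrightarrow> (real i + real j) / 2 \<notin> X i j"
    and zero: "\<And>i j. 1 \<le> i \<Longrightarrow> i < j \<Longrightarrow> j \<le> m \<Longrightarrow> 0 \<in> X i j"
    and cross: "\<And>i j k. 1 \<le> i \<Longrightarrow> i < j \<Longrightarrow> j \<le> m \<Longrightarrow> 1 \<le> k \<Longrightarrow> k \<le> m \<Longrightarrow> k \<noteq> j \<Longrightarrow> k \<noteq> i \<Longrightarrow>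
      (real i + real k) / 2 \<in> X i j"
    and P: "\<And>i j. 1 \<le> i \<Longrightarrow> i < j \<Longrightarrow> j \<le> m \<Longrightarrow> P (S (i, j))"
  shows "disjointness_representable (shift_graph m) P"
proof (rule disjointness_representable_shiftI[where S = S])
  fix u v assume uv: "u \<in> verts (shift_graph m)" "v \<in> verts (shift_graph m)"
  show "S u \<inter> S v = {} \<longleftrightarrow> adj (shift_graph m) u v"
  proof (rule shift_disjoint_iff[OF _ _ uv])
    fix i j k :: nat assume ijk: "1 \<le> i" "i < j" "j < k" "k \<le> m"
    have "v $ 1 = (real i + real j) / 2" if "v \<in> S (i, j) \<inter> S (j, k)" for v
      using that ijk by (intro tangents_cross) (auto simp: S_def)
    moreover have "v $ 1 \<in> X i j" if "v \<in> S (i, j)" for v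
      using that by (simp add: S_def)
    ultimately show "S (i, j) \<inter> S (j, k) = {}"
      using gap[of i j] ijk by fastforce
  next
    fix i j k l :: nat
    assume ijkl: "1 \<le> i" "i < j" "j \<le> m" "i \<le> k" "k < l" "l \<le> m" "j \<noteq> k"
    show "S (i, j) \<inter> S (k, l) \<noteq> {}"
    proof (cases "i = k")
      case True
      then have "vector [0, - (real i)\<^sup>2] \<in> S (i, j) \<inter> S (k, l)"
        using ijkl zero by (simp add: S_def)
      then show ?thesis by blast
    next
      case False
      have "(real i + real k) / 2 \<in> X i j" "(real i + real k) / 2 \<in> X k l"
        using cross[of i j k] cross[of k l i] False ijkl by (simp_all add: add.commute)
      then have "vector [(real i + real k) / 2, real i * real k] \<in> S (i, j) \<inter> S (k, l)"
        by (simp add: S_def power2_eq_square algebra_simps)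
      then show ?thesis by blast
    qed
  qed
qed (use P in \<open>auto simp: shift_graph_def\<close>)

lemma line_minus_point_representation:
  "disjointness_representable (shift_graph m) (is_line_minus_point :: (real^2) set \<Rightarrow> bool)"
proof (rule tangents_representation[where X = "\<lambda>i j. - {(real i + real j) / 2}"])
  fix i j :: nat
  let ?L = "{v :: real^2. v $ 2 = 2 * real i * v $ 1 + - (real i)\<^sup>2}"
  let ?p = "vector [(real i + real j) / 2, 2 * real i * ((real i + real j) / 2) + - (real i)\<^sup>2] :: real^2"
  have "(case (i, j) of (i, j) \<Rightarrow> {v :: real^2. v $ 2 = 2 * real i * v $ 1 - (real i)\<^sup>2 \<and>
      v $ 1 \<in> - {(real i + real j) / 2}}) = ?L - {?p}"
    by (auto simp: vec2_eq_iff)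
  moreover have "?p \<in> ?L" by simp
  ultimately show "is_line_minus_point (case (i, j) of (i, j) \<Rightarrow>
      {v :: real^2. v $ 2 = 2 * real i * v $ 1 - (real i)\<^sup>2 \<and> v $ 1 \<in> - {(real i + real j) / 2}})"
    unfolding is_line_minus_point_def using is_line_graph by blast
qed auto

lemma two_segments_representation:
  "disjointness_representable (shift_graph m) (is_union_of_two_segments :: (real^2) set \<Rightarrow> bool)"
\<comment> \<open>Crossings on one tangent are at least 1/2 apart, so a gap of radius 1/4 removes
  just one of them; all crossings lie between 0 and \<open>m\<close>.\<close>
proof (rule tangents_representation[where
      X = "\<lambda>i j. {0..(real i + real j) / 2 - 1/4} \<union> {(real i + real j) / 2 + 1/4..real m + 1}"])
  fix i j k :: nat
  assume "1 \<le> i" "i < j" "j \<le> m" "1 \<le> k" "k \<le> m" "k \<noteq> j"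
  moreover from \<open>k \<noteq> j\<close> have "real k + 1 \<le> real j \<or> real j + 1 \<le> real k" by linarith
  ultimately show "(real i + real k) / 2 \<in>
      {0..(real i + real j) / 2 - 1/4} \<union> {(real i + real j) / 2 + 1/4..real m + 1}"
    by (auto simp: field_simps)
next
  fix i j :: nat
  assume ij: "1 \<le> i" "i < j" "j \<le> m"
  let ?t = "\<lambda>x. vector [x, 2 * real i * x + - (real i)\<^sup>2] :: real^2"
  let ?a = "(real i + real j) / 2 - 1/4" and ?b = "(real i + real j) / 2 + 1/4"
  have ord: "0 < ?a" "?b < real m + 1"
    using ij by (simp_all add: field_simps)
  have "(case (i, j) of (i, j) \<Rightarrow> {v :: real^2. v $ 2 = 2 * real i * v $ 1 - (real i)\<^sup>2 \<and>
      v $ 1 \<in> {0..(real i + real j) / 2 - 1/4} \<union> {(real i + real j) / 2 + 1/4..real m + 1}}) =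
      closed_segment (?t 0) (?t ?a) \<union> closed_segment (?t ?b) (?t (real m + 1))"
    unfolding closed_segment_graph[OF less_imp_le[OF ord(1)]]
      closed_segment_graph[OF less_imp_le[OF ord(2)]] by auto
  moreover have "?t 0 \<noteq> ?t ?a" "?t ?b \<noteq> ?t (real m + 1)"
    using ord by (simp_all add: vec2_eq_iff)
  ultimately show "is_union_of_two_segments (case (i, j) of (i, j) \<Rightarrow>
      {v :: real^2. v $ 2 = 2 * real i * v $ 1 - (real i)\<^sup>2 \<and>
      v $ 1 \<in> {0..(real i + real j) / 2 - 1/4} \<union> {(real i + real j) / 2 + 1/4..real m + 1}})"
    unfolding is_union_of_two_segments_def by blast
next
  fix i j :: nat
  assume "1 \<le> i" "i < j" "j \<le> m"
  then show "0 \<in> {0..(real i + real j) / 2 - 1/4} \<union> {(real i + real j) / 2 + 1/4..real m + 1}"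
    by (simp add: field_simps)
next
  have "c \<notin> {0..c - 1/4} \<union> {c + 1/4..d}" for c d :: real
    by simp
  then show "(real i + real j) / 2 \<notin>
      {0..(real i + real j) / 2 - 1/4} \<union> {(real i + real j) / 2 + 1/4..real m + 1}" for i j :: nat .
qed

subsection \<open>Curves of four segments\<close>

text \<open>The points \<open>T\<^sub>i = (i, curve_top m i)\<close> lie on a concave curve. The curve of \<open>(i, j)\<close> runs
  down from \<open>T\<^sub>i\<close> to \<open>(i, - 2 * i)\<close>, back along \<open>x + y = - i\<close> to the left end of a line, along this
  line to a point just above \<open>T\<^sub>j\<close>, and from there horizontally to the right. The line is the chord
  \<open>T\<^sub>i T\<^sub>j\<close> raised by \<open>i / m\<close>, so by concavity it crosses the vertical segments strictly between
  \<open>i\<close> and \<open>j\<close>, while the horizontal ray crosses those beyond \<open>j\<close>. The whole curve of \<open>(i, j)\<close>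
  lies strictly below the raised chord of \<open>(j, k)\<close>, because the raise grows with the first index.\<close>

definition curve_top :: "real \<Rightarrow> real \<Rightarrow> real" where
  "curve_top m i = 2 * m * i - i\<^sup>2"

definition chord :: "real \<Rightarrow> real \<Rightarrow> real \<Rightarrow> real \<Rightarrow> real" where
  "chord m i j x = (2 * m - i - j) * x + (i * j + i / m)"

text \<open>The abscissa at which the raised chord meets \<open>x + y = - i\<close>.\<close>
definition curve_turn :: "real \<Rightarrow> real \<Rightarrow> real \<Rightarrow> real" where
  "curve_turn m i j = - (i + i * j + i / m) / (1 + 2 * m - i - j)"

text \<open>The lower end is where the vertical line \<open>x = i\<close> meets
  \<open>x + y = - i\<close>.\<close>

definition curve_down :: "real \<Rightarrow> real \<Rightarrow> (real^2) set" where
  "curve_down m i = {v. v $ 1 = i \<and> - 2 * i \<le> v $ 2 \<and> v $ 2 \<le> curve_top m i}"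

definition curve_back :: "real \<Rightarrow> real \<Rightarrow> real \<Rightarrow> (real^2) set" where
  "curve_back m i j = {v. v $ 2 = - v $ 1 - i \<and> curve_turn m i j \<le> v $ 1 \<and> v $ 1 \<le> i}"

definition curve_chord :: "real \<Rightarrow> real \<Rightarrow> real \<Rightarrow> (real^2) set" where
  "curve_chord m i j = {v. v $ 2 = chord m i j (v $ 1) \<and> curve_turn m i j \<le> v $ 1 \<and> v $ 1 \<le> j}"

text \<open>Ending at \<open>m + 1\<close> keeps this segment nondegenerate for
  \<open>j = m\<close>.\<close>

definition curve_out :: "real \<Rightarrow> real \<Rightarrow> real \<Rightarrow> (real^2) set" where
  "curve_out m i j = {v. v $ 2 = chord m i j j \<and> j \<le> v $ 1 \<and> v $ 1 \<le> m + 1}"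

definition curve :: "real \<Rightarrow> real \<Rightarrow> real \<Rightarrow> (real^2) set" where
  "curve m i j = curve_down m i \<union> curve_back m i j \<union> curve_chord m i j \<union> curve_out m i j"

section \<open>Inequalities between raised chords and the parabola\<close>

lemma chord_right: "chord m i j j = curve_top m j + i / m"
  by (simp add: chord_def curve_top_def algebra_simps power2_eq_square)

text \<open>A parabola with leading coefficient -1 differs from its chord by
  \<open>(x - i) * (x - j)\<close>: the unraised chord is below it between \<open>i\<close> and
  \<open>j\<close> and above it outside.\<close>

lemma chord_eq: "chord m i j x = curve_top m x + (x - i) * (x - j) + i / m"
  by (simp add: chord_def curve_top_def algebra_simps power2_eq_square)

lemma chord_mono:
  assumes "i + j \<le> 2 * m" "x \<le> y"
  shows "chord m i j x \<le> chord m i j y"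
  using mult_left_mono[of x y "2 * m - i - j"] assms by (simp add: chord_def)

text \<open>The unraised chords share the point T_j, so only their slopes and the raises contribute.
  For \<open>i < j < k\<close> and \<open>x \<le> j\<close> neither term is negative.\<close>

lemma chord_diff: "chord m j k x - chord m i j x = (k - i) * (j - x) + (j - i) / m"
  by (simp add: chord_def algebra_simps diff_divide_distrib)

lemma curve_top_mono:
  assumes "i + 1 \<le> j" "j \<le> m"
  shows "curve_top m i + 1 \<le> curve_top m j"
proof -
  have "1 * 1 \<le> (j - i) * (2 * m - i - j)"
    using assms by (intro mult_mono) auto
  then show ?thesis
    by (simp add: curve_top_def algebra_simps power2_eq_square)
qed

lemma curve_top_pos:
  assumes "1 \<le> i" "i \<le> m"
  shows "0 < curve_top m i"
proof -
  have "0 < i * (2 * m - i)"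
    using assms by (intro mult_pos_pos) auto
  then show ?thesis by (simp add: curve_top_def algebra_simps power2_eq_square)
qed

lemma curve_turn:
  assumes "1 \<le> i" "i + 1 \<le> j" "j \<le> m"
  shows "chord m i j (curve_turn m i j) = - curve_turn m i j - i" "curve_turn m i j < 0"
proof -
  let ?d = "1 + 2 * m - i - j"
  have d: "0 < ?d" using assms by simp
  have "curve_turn m i j * ?d = - (i + i * j + i / m)"
    using d by (simp add: curve_turn_def)
  then show "chord m i j (curve_turn m i j) = - curve_turn m i j - i"
    by (simp add: chord_def algebra_simps)
  have "0 < i + i * j + i / m"
    using assms by (intro add_pos_pos mult_pos_pos divide_pos_pos) auto
  then show "curve_turn m i j < 0"
    using d unfolding curve_turn_def by (intro divide_neg_pos) auto
qed

text \<open>Each bound avoids one part of a curve of \<open>(j, k)\<close>: its back segment on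
  \<open>x + y = - j\<close>, its horizontal end, and its vertical segment at \<open>j\<close>. The
  chord part is left to \<open>curve_below_chord\<close>.\<close>

lemma curve_bounds:
  assumes ij: "1 \<le> i" "i + 1 \<le> j" "j \<le> m" and v: "v \<in> curve m i j"
  shows "- i \<le> v $ 1 + v $ 2" "v $ 2 \<le> chord m i j j"
    "v $ 1 = j \<Longrightarrow> curve_top m j < v $ 2"
proof -
  note turn = curve_turn[OF ij]
  have im: "0 < i / m" using ij by simp
  have sum: "i + j \<le> 2 * m" using ij by simp
  have top: "0 < curve_top m i" "curve_top m i + 1 \<le> curve_top m j"
    using curve_top_pos curve_top_mono ij by auto
  consider "v \<in> curve_down m i" | "v \<in> curve_back m i j" | "v \<in> curve_chord m i j"
    | "v \<in> curve_out m i j"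
    using v by (auto simp: curve_def)
  then have "- i \<le> v $ 1 + v $ 2 \<and> v $ 2 \<le> chord m i j j \<and> (v $ 1 = j \<longrightarrow> curve_top m j < v $ 2)"
  proof cases
    case 1
    moreover from this have "v $ 2 \<le> chord m i j j"
      using top im unfolding curve_down_def chord_right mem_Collect_eq by linarith
    ultimately show ?thesis using ij by (simp add: curve_down_def)
  next
    case 2
    then have "v $ 2 \<le> chord m i j (curve_turn m i j)"
      using turn by (simp add: curve_back_def)
    also have "\<dots> \<le> chord m i j j"
      using turn ij by (intro chord_mono sum) simp
    finally show ?thesis using 2 ij by (simp add: curve_back_def)
  next
    case 3
    then have "chord m i j (curve_turn m i j) \<le> v $ 2" "v $ 2 \<le> chord m i j j"
      by (simp_all add: curve_chord_def chord_mono sum)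
    then show ?thesis using 3 turn im by (auto simp: curve_chord_def chord_right)
  next
    case 4
    then show ?thesis
      using ij top im unfolding curve_out_def chord_right mem_Collect_eq by linarith
  qed
  then show "- i \<le> v $ 1 + v $ 2" "v $ 2 \<le> chord m i j j"
    "v $ 1 = j \<Longrightarrow> curve_top m j < v $ 2" by auto
qed

lemma curve_below_chord:
  assumes ij: "1 \<le> i" "i + 1 \<le> j" "j + 1 \<le> k" "k \<le> m" and v: "v \<in> curve m i j"
  shows "v $ 2 < chord m j k (v $ 1)"
proof -
  have turn: "chord m i j (curve_turn m i j) = - curve_turn m i j - i" "curve_turn m i j < 0"
    using curve_turn ij by auto
  have sum: "j + k \<le> 2 * m" using ij by simp
  have below: "chord m i j x < chord m j k x" if "x \<le> j" for x
  proof -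
    have "0 \<le> (k - i) * (j - x)" "0 < (j - i) / m"
      using ij that by auto
    then show ?thesis using chord_diff[of m j k x i] by linarith
  qed
  consider "v \<in> curve_down m i" | "v \<in> curve_back m i j" | "v \<in> curve_chord m i j"
    | "v \<in> curve_out m i j"
    using v by (auto simp: curve_def)
  then show ?thesis
  proof cases
    case 1
    have "0 \<le> (i - j) * (i - k)" "0 < j / m"
      using ij by (auto intro: mult_nonpos_nonpos)
    then have "curve_top m i < chord m j k i" by (simp add: chord_eq)
    then show ?thesis using 1 by (auto simp: curve_down_def)
  next
    case 2
    \<comment> \<open>The back segment falls to the right while the chord of \<open>(j, k)\<close>
      does not, so it suffices to compare at the turning point, which lies on the chord of
      \<open>(i, j)\<close>.\<close>
    then have "v $ 2 \<le> chord m i j (curve_turn m i j)"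
      using turn by (simp add: curve_back_def)
    also have "\<dots> < chord m j k (curve_turn m i j)"
      using turn ij by (intro below) simp
    also have "\<dots> \<le> chord m j k (v $ 1)"
      using 2 by (intro chord_mono sum) (simp add: curve_back_def)
    finally show ?thesis .
  next
    case 3
    then show ?thesis using below by (simp add: curve_chord_def)
  next
    case 4
    then have "v $ 2 < chord m j k j"
      using below[of j] by (simp add: curve_out_def)
    also have "\<dots> \<le> chord m j k (v $ 1)"
      using 4 by (intro chord_mono sum) (simp add: curve_out_def)
    finally show ?thesis .
  qed
qed

section \<open>Intersection pattern of the curves\<close>

lemma curve_disjoint:
  assumes ijk: "1 \<le> i" "i + 1 \<le> j" "j + 1 \<le> k" "k \<le> m"
  shows "curve m i j \<inter> curve m j k = {}"
proof -
  have False if v: "v \<in> curve m i j" "v \<in> curve m j k" for v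
  proof -
    have ij: "1 \<le> i" "i + 1 \<le> j" "j \<le> m" using ijk by auto
    note b = curve_bounds[OF ij v(1)] curve_below_chord[OF ijk v(1)]
    have "chord m i j j < chord m j k j"
      using ij ijk by (simp add: chord_eq divide_strict_right_mono)
    also have "\<dots> \<le> chord m j k k"
      using ijk by (intro chord_mono) auto
    finally have out: "v $ 2 < chord m j k k" using b(2) by simp
    consider "v \<in> curve_down m j" | "v \<in> curve_back m j k" | "v \<in> curve_chord m j k"
      | "v \<in> curve_out m j k"
      using v(2) by (auto simp: curve_def)
    then show False
    proof cases
      case 1
      then show False using b(3) by (simp add: curve_down_def)
    next
      case 2
      then show False using b(1) ijk by (simp add: curve_back_def)
    next
      case 3
      then show False using b(4) by (simp add: curve_chord_def)
    next
      case 4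
      then show False using out by (simp add: curve_out_def)
    qed
  qed
  then show ?thesis by blast
qed

text \<open>The common point is always found on the vertical segment of \<open>(k, l)\<close> at
  abscissa \<open>k\<close>. The curve of \<open>(i, j)\<close> reaches it by its own vertical
  segment, its chord or its horizontal end, according to the position of \<open>k\<close>.\<close>

lemma curves_meet:
  assumes ij: "1 \<le> i" "i + 1 \<le> j" "j \<le> m" and kl: "k + 1 \<le> l" "l \<le> m"
    and ik: "i = k \<or> i + 1 \<le> k" and jk: "j + 1 \<le> k \<or> k + 1 \<le> j"
  shows "curve m i j \<inter> curve m k l \<noteq> {}"
proof -
  have im: "0 < i / m" "i / m \<le> 1" using ij by auto
  have k: "1 \<le> k" using ij ik by auto
  have top: "0 < curve_top m i" "0 < curve_top m j" "0 < curve_top m k"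
    using curve_top_pos ij kl k by auto
  consider "i = k" | "i + 1 \<le> k" "k + 1 \<le> j" | "i + 1 \<le> k" "j + 1 \<le> k"
    using ik jk by auto
  then obtain y where y: "vector [k, y] \<in> curve m i j" "- 2 * k \<le> y" "y \<le> curve_top m k"
  proof cases
    case 1
    then have "vector [k, curve_top m k] \<in> curve m i j"
      using ij top by (simp add: curve_def curve_down_def)
    then show ?thesis using that k top by simp
  next
    case 2
    have "vector [k, chord m i j k] \<in> curve m i j"
      using 2 curve_turn(2)[OF ij] k by (simp add: curve_def curve_chord_def)
    moreover have "chord m i j i \<le> chord m i j k"
      using 2 ij by (intro chord_mono) auto
    then have "- 2 * k \<le> chord m i j k"
      using top im k by (simp add: chord_eq[of m i j i])
    \<comment> \<open>Unit gaps put the unraised chord at least 1 below T_k, which absorbs the raise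
      \<open>i / m \<le> 1\<close>. In the last case the growth of \<open>curve_top\<close> from
      \<open>j\<close> to \<open>k\<close> does the same.\<close>
    moreover have "1 * 1 \<le> (k - i) * (j - k)"
      using 2 by (intro mult_mono) auto
    then have "chord m i j k \<le> curve_top m k"
      using im by (simp add: chord_eq algebra_simps)
    ultimately show ?thesis using that by blast
  next
    case 3
    have "vector [k, chord m i j j] \<in> curve m i j"
      using 3 kl by (simp add: curve_def curve_out_def)
    moreover have "curve_top m j + 1 \<le> curve_top m k"
      using 3 kl by (intro curve_top_mono) auto
    then have "- 2 * k \<le> chord m i j j" "chord m i j j \<le> curve_top m k"
      using im top k unfolding chord_right by linarith+
    ultimately show ?thesis using that by blast
  qed
  then have "vector [k, y] \<in> curve m k l"
    by (simp add: curve_def curve_down_def)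
  with y show ?thesis by blast
qed

lemma is_four_segment_curve_curve:
  assumes ij: "1 \<le> i" "i + 1 \<le> j" "j \<le> m"
  shows "is_four_segment_curve (curve m i j)"
proof -
  let ?x = "curve_turn m i j"
  let ?p0 = "vector [i, curve_top m i] :: real^2" and ?p1 = "vector [i, - 2 * i] :: real^2"
    and ?p2 = "vector [?x, - ?x - i] :: real^2"
    and ?p3 = "vector [j, chord m i j j] :: real^2" and ?p4 = "vector [m + 1, chord m i j j] :: real^2"
  note turn = curve_turn[OF ij]
  have "0 < curve_top m i" using curve_top_pos ij by simp
  then have ne: "?p0 \<noteq> ?p1" "?p1 \<noteq> ?p2" "?p2 \<noteq> ?p3" "?p3 \<noteq> ?p4"
    using ij turn by (auto simp: vec2_eq_iff)
  have "closed_segment ?p0 ?p1 = curve_down m i"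
    using ij \<open>0 < curve_top m i\<close> by (subst closed_segment_vertical) (auto simp: curve_down_def)
  moreover have "closed_segment ?p1 ?p2 = curve_back m i j"
    using closed_segment_graph[of ?x i "- 1" "- i"] ij turn
    by (simp add: closed_segment_commute curve_back_def)
  \<comment> \<open>\<open>?p2\<close> is given by its position on the back line; by the choice of
    \<open>curve_turn\<close> it also lies on the raised chord.\<close>
  moreover have "closed_segment ?p2 ?p3 = curve_chord m i j"
    using closed_segment_graph[of ?x j "2 * m - i - j" "i * j + i / m"] ij turn(2)
    unfolding turn(1)[symmetric] by (simp add: curve_chord_def chord_def)
  moreover have "closed_segment ?p3 ?p4 = curve_out m i j"
    using closed_segment_graph[of j "m + 1" 0 "chord m i j j"] ij
    by (simp add: curve_out_def)
  ultimately have "curve m i j = path_image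
      (linepath ?p0 ?p1 +++ linepath ?p1 ?p2 +++ linepath ?p2 ?p3 +++ linepath ?p3 ?p4)"
    by (simp add: path_image_join curve_def Un_assoc)
  with ne show ?thesis
    unfolding is_four_segment_curve_def by blast
qed

lemma four_segment_representation:
  "disjointness_representable (shift_graph m) (is_four_segment_curve :: (real^2) set \<Rightarrow> bool)"
proof (rule disjointness_representable_shiftI[where S = "\<lambda>(i, j). curve (real m) (real i) (real j)"])
  fix u v assume uv: "u \<in> verts (shift_graph m)" "v \<in> verts (shift_graph m)"
  show "(case u of (i, j) \<Rightarrow> curve (real m) (real i) (real j)) \<inter>
      (case v of (i, j) \<Rightarrow> curve (real m) (real i) (real j)) = {} \<longleftrightarrow> adj (shift_graph m) u v"
  proof (rule shift_disjoint_iff[OF _ _ uv])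
    fix i j k :: nat assume "1 \<le> i" "i < j" "j < k" "k \<le> m"
    then show "(case (i, j) of (i, j) \<Rightarrow> curve (real m) (real i) (real j)) \<inter>
        (case (j, k) of (i, j) \<Rightarrow> curve (real m) (real i) (real j)) = {}"
      using curve_disjoint[of i j k m] by simp
  next
    fix i j k l :: nat
    assume "1 \<le> i" "i < j" "j \<le> m" "i \<le> k" "k < l" "l \<le> m" "j \<noteq> k"
    then show "(case (i, j) of (i, j) \<Rightarrow> curve (real m) (real i) (real j)) \<inter>
        (case (k, l) of (i, j) \<Rightarrow> curve (real m) (real i) (real j)) \<noteq> {}"
      using curves_meet[of i j m k l] by simp linarith
  qed
next
  fix v assume "v \<in> verts (shift_graph m)"
  then show "is_four_segment_curve (case v of (i, j) \<Rightarrow> curve (real m) (real i) (real j))"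
    using is_four_segment_curve_curve by (auto simp: shift_graph_def)
qed

theorem theorem5p2:
  fixes m :: nat
  assumes "m > 1"
  shows
    "disjointness_representable (shift_graph m) (is_line_minus_point :: (real^2) set \<Rightarrow> bool) \<and>
     disjointness_representable (shift_graph m) (is_plane :: (real^4) set \<Rightarrow> bool) \<and>
     disjointness_representable (shift_graph m) (is_halfspace_intersection :: (real^3) set \<Rightarrow> bool) \<and>
     disjointness_representable (shift_graph m) (is_union_of_two_segments :: (real^2) set \<Rightarrow> bool) \<and>
     disjointness_representable (shift_graph m) (\<lambda>T :: (real^4) set. 2 simplex T) \<and>
     disjointness_representable (shift_graph m) (\<lambda>T :: (real^3) set. 3 simplex T) \<and>
     disjointness_representable (shift_graph m) (is_four_segment_curve :: (real^2) set \<Rightarrow> bool)"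
  using line_minus_point_representation plane_representation halfspace_representation
    two_segments_representation triangle_representation tetrahedron_representation
    four_segment_representation
  by (intro conjI)

end
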